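(* Let $n \geq 6$ be an even integer, $p$ an odd prime and $k \geq 2$ an integer. Suppose that $\phi(p^k) < \lceil \log_2 n \rceil$, that $p^k$ divides $n$, and that $2$ is a primitive root modulo $p^k$. Then $\gamma(KG_n) \leq \frac{2n}{p^k}$.
   Context: $\phi$ denotes Euler's totient function. For even $n \geq 6$, the Knödel graph $KG_n$ has vertex set $\{0,1,\dots,n-1\}$, and $\{x,y\}$ is an edge if and only if $x + y \equiv 2^t - 1 \pmod n$ for some $t \in \{1,2,\dots,\lfloor \log_2 n\rfloor\}$. A dominating set of a graph $G$ is a set $D$ of vertices such that every vertex is in $D$ or adjacent to a vertex of $D$; $\gamma(G)$ denotes the minimum size of a dominating set. *)

theory Defs
  imports Complex_Main "HOL-Number_Theory.Number_Theory"
begin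

text \<open>A simple graph is given by its vertex set and its set of edges, an edge being the
  unordered pair \<open>{u, v}\<close> of its endpoints.\<close>

definition dominating_set :: "'a set \<Rightarrow> 'a set set \<Rightarrow> 'a set \<Rightarrow> bool" where
  "dominating_set V E D \<longleftrightarrow> D \<subseteq> V \<and> (\<forall>v\<in>V. v \<in> D \<or> (\<exists>u\<in>D. {u, v} \<in> E))"

text \<open>Finiteness of \<open>D\<close> is automatic for finite \<open>V\<close>; it is demanded because infinite sets
  have \<open>card\<close> 0.\<close>

definition domination_number :: "'a set \<Rightarrow> 'a set set \<Rightarrow> nat" where
  "domination_number V E = (LEAST m. \<exists>D. dominating_set V E D \<and> finite D \<and> card D = m)"

definition knodel_verts :: "nat \<Rightarrow> nat set" where
  "knodel_verts n = {0..<n}"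

definition knodel_edges :: "nat \<Rightarrow> nat set set" where
  "knodel_edges n = {{x, y} | x y. x \<in> knodel_verts n \<and> y \<in> knodel_verts n \<and>
     (\<exists>t::nat. 1 \<le> t \<and> int t \<le> \<lfloor>log 2 (real n)\<rfloor> \<and> [x + y = 2 ^ t - 1] (mod n))}"

text \<open>For even \<open>n\<close> the adjacency condition makes \<open>x + y\<close> odd, so there are no loops.\<close>

lemma knodel_edges_card:
  assumes "even n" "e \<in> knodel_edges n"
  shows "card e = 2"
proof -
  obtain x y and t :: nat where e: "e = {x, y}" and t: "1 \<le> t"
    and c: "[x + y = 2 ^ t - 1] (mod n)"
    using assms(2) unfolding knodel_edges_def by blast
  have "[x + y = 2 ^ t - 1] (mod 2)"
    using c assms(1) by (rule cong_dvd_modulus_nat)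
  moreover have "odd (2 ^ t - 1 :: nat)"
    using t by simp
  ultimately have "odd (x + y)"
    by (metis cong_dvd_iff)
  then have "x \<noteq> y"
    by auto
  then show ?thesis
    by (simp add: e)
qed

end

theory Submission
  imports Defs
begin

text \<open>Put \<open>m = p ^ k\<close>. The powers \<open>2 ^ t\<close> with \<open>1 \<le> t \<le> \<phi> m\<close> are all allowed in the edge
  relation and run through all units modulo \<open>m\<close>, so the vertices congruent to \<open>a\<close> modulo \<open>m\<close>
  dominate every \<open>x\<close> with \<open>x + a + 1\<close> prime to \<open>p\<close>. As \<open>p\<close> cannot divide both \<open>x + 1\<close> and
  \<open>x + 2\<close>, the two residue classes of \<open>0\<close> and \<open>1\<close> together dominate the graph.\<close>

text \<open>The exponents below \<open>totient m\<close> already reach every unit. Edges require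
  \<open>1 \<le> t\<close>, so exponent 0 is traded for \<open>totient m\<close> by Euler's
  theorem.\<close>

lemma residue_primroot_power_cong:
  assumes "residue_primroot m g" "m > 1" "coprime u m"
  obtains t where "1 \<le> t" "t \<le> totient m" "[g ^ t = u] (mod m)"
proof -
  have cop: "coprime m g"
    using assms(1) by (auto simp: residue_primroot_def)
  have "u mod m \<in> totatives m"
    using assms(2,3) coprime_absorb_left[of m u]
    by (auto simp: in_totatives_iff mod_greater_zero_iff_not_dvd intro: less_imp_le)
  then obtain i where i: "i < totient m" "g ^ i mod m = u mod m"
    using residue_primroot_is_generator[OF assms(2,1)] unfolding bij_betw_def by force
  show ?thesis
  proof (cases "i = 0")
    case True
    then have "[g ^ totient m = u] (mod m)"
      using euler_theorem[of g m] cop i by (simp add: cong_def coprime_commute)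
    then show ?thesis
      using that[of "totient m"] i by simp
  next
    case False
    then show ?thesis
      using that[of i] i by (simp add: cong_def)
  qed
qed

lemma domination_number_le_card:
  assumes "dominating_set V E D" "finite D"
  shows "domination_number V E \<le> card D"
  unfolding domination_number_def using assms by (intro Least_le) blast

text \<open>Each \<open>y\<close> is recovered from \<open>(y mod m, y div m)\<close>, and
  \<open>m dvd n\<close> keeps the quotient below \<open>n div m\<close>.\<close>

lemma card_residue_classes_le:
  fixes m n :: nat
  assumes "m dvd n" "finite A"
  shows "card {y. y < n \<and> y mod m \<in> A} \<le> card A * (n div m)"
proof -
  have "{y. y < n \<and> y mod m \<in> A} \<subseteq> (\<lambda>(r, q). q * m + r) ` (A \<times> {..<n div m})"
  proof
    fix y assume y: "y \<in> {y. y < n \<and> y mod m \<in> A}"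
    then have "y div m < n div m"
      using assms(1) less_mult_imp_div_less[of y "n div m" m] by simp
    then show "y \<in> (\<lambda>(r, q). q * m + r) ` (A \<times> {..<n div m})"
      using y by (intro image_eqI[of _ _ "(y mod m, y div m)"]) auto
  qed
  then have "card {y. y < n \<and> y mod m \<in> A} \<le> card (A \<times> {..<n div m})"
    using assms(2) by (intro surj_card_le) auto
  then show ?thesis
    by (simp add: card_cartesian_product)
qed

lemma knodel_neighbour_in_residue_class:
  fixes x a m n t :: nat
  assumes "x < n" "m dvd n" "1 \<le> t" "int t \<le> \<lfloor>log 2 (real n)\<rfloor>"
    and "[2 ^ t = x + a + 1] (mod m)"
  obtains y where "y < n" "y mod m = a mod m" "{y, x} \<in> knodel_edges n"
proof
  \<comment> \<open>Solves \<open>x + y = 2 ^ t - 1\<close> modulo \<open>n\<close>;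
    \<open>n - x\<close> plays the part of \<open>-x\<close> without truncation.\<close>
  define y where "y = (2 ^ t - 1 + (n - x)) mod n"
  show "y < n"
    using assms(1) by (simp add: y_def)
  have "[x + y = x + (2 ^ t - 1 + (n - x))] (mod n)"
    unfolding y_def cong_def by (simp add: mod_simps)
  also have "x + (2 ^ t - 1 + (n - x)) = (2 ^ t - 1) + n"
    using assms(1) by simp
  finally have *: "[x + y = 2 ^ t - 1] (mod n)"
    by (simp only: cong_def mod_add_self2)
  then show "{y, x} \<in> knodel_edges n"
    unfolding knodel_edges_def knodel_verts_def
    using assms(1,3,4) \<open>y < n\<close> by (force simp: insert_commute)
  have "[x + y = 2 ^ t - 1] (mod m)"
    using * assms(2) by (rule cong_dvd_modulus_nat)
  \<comment> \<open>Adding 1 undoes the natural subtraction, so that \<open>x + 1\<close> can be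
    cancelled against the hypothesis on \<open>2 ^ t\<close>.\<close>
  then have "[x + y + 1 = 2 ^ t - 1 + 1] (mod m)"
    by (rule cong_add) simp
  then have "[x + 1 + y = x + 1 + a] (mod m)"
    using assms(5) by (auto simp: algebra_simps intro: cong_trans)
  then show "y mod m = a mod m"
    by (simp only: cong_add_lcancel_nat) (simp add: cong_def)
qed

theorem theorem8:
  fixes n p k :: nat
  assumes "n \<ge> 6" and "even n"
    and "prime p" and "odd p"
    and "k \<ge> 2"
    and "int (totient (p ^ k)) < \<lceil>log 2 (real n)\<rceil>"
    and "p ^ k dvd n"
    and "residue_primroot (p ^ k) 2"
  shows "real (domination_number (knodel_verts n) (knodel_edges n)) \<le> 2 * real n / real (p ^ k)"
proof -
  define m where "m = p ^ k"
  define D where "D = {y. y < n \<and> y mod m \<in> {0, 1}}"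
  have m: "m > 1"
    using assms(3,5) prime_gt_1_nat[of p] one_less_power[of p k] by (simp add: m_def)
  have dominated: "\<exists>u\<in>D. {u, x} \<in> knodel_edges n"
    if xa: "x < n" "a \<in> {0, 1}" "\<not> p dvd x + a + 1" for x a
  proof -
    have "coprime (x + a + 1) m"
      using xa assms(3) by (simp add: m_def prime_imp_coprime coprime_commute)
    then obtain t where t: "1 \<le> t" "t \<le> totient m" "[2 ^ t = x + a + 1] (mod m)"
      using residue_primroot_power_cong[of m 2] assms(8) m by (metis m_def)
    \<comment> \<open>A ceiling exceeds the floor by at most 1, so the strict bound on
      \<open>totient m\<close> passes to the floor.\<close>
    then have "int t \<le> \<lfloor>log 2 (real n)\<rfloor>"
      using assms(6) ceiling_diff_floor_le_1[of "log 2 (real n)"] by (simp add: m_def)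
    then obtain y where "y < n" "y mod m = a mod m" "{y, x} \<in> knodel_edges n"
      using knodel_neighbour_in_residue_class[of x n m t a] xa(1) t(1,3) assms(7)
      unfolding m_def by blast
    then show ?thesis
      using xa m by (auto simp: D_def)
  qed
  have "dominating_set (knodel_verts n) (knodel_edges n) D"
    unfolding dominating_set_def
  \<comment> \<open>\<open>disjI2\<close> is safe: even the members of \<open>D\<close> have a
    neighbour in \<open>D\<close>.\<close>
  proof (intro conjI ballI disjI2)
    show "D \<subseteq> knodel_verts n"
      by (auto simp: D_def knodel_verts_def)
    fix x assume x: "x \<in> knodel_verts n"
    have "\<not> (p dvd x + 0 + 1 \<and> p dvd x + 1 + 1)"
      using assms(3) by (metis add.right_neutral dvd_add_right_iff not_prime_unit)
    then show "\<exists>u\<in>D. {u, x} \<in> knodel_edges n"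
      using dominated[of x 0] dominated[of x 1] x by (auto simp: knodel_verts_def)
  qed
  then have "domination_number (knodel_verts n) (knodel_edges n) \<le> card D"
    by (rule domination_number_le_card) (simp add: D_def)
  also have "\<dots> \<le> 2 * (n div m)"
    using card_residue_classes_le[of m n "{0, 1}"] assms(7) by (simp add: D_def m_def)
  finally have "real (domination_number (knodel_verts n) (knodel_edges n)) \<le> real (2 * (n div m))"
    by (rule of_nat_mono)
  \<comment> \<open>The division is exact because \<open>m\<close> divides \<open>n\<close>.\<close>
  also have "\<dots> = 2 * real n / real m"
    using assms(7) by (simp add: m_def real_of_nat_div)
  finally show ?thesis
    by (simp add: m_def)
qed

end
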